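(* Let $L>0$, $T>0$, $K,M$ positive integers, $\Delta x=L/K$, $\Delta t=T/M$, and $\hat L=\sqrt2\max\{\sqrt L,1/\sqrt L\}$. Let $(E,N,V)$ be a solution of the periodic Zakharov system $$\mathrm{i}E_t+E_{xx}=NE,\qquad N_t=V_{xx},\qquad V_t=N+|E|^2,\qquad V(0,0)=0$$ ($L$-periodic in $x$, initial data $E(0,\cdot)=E^0$, $N(0,\cdot)=N^0$, $N_t(0,\cdot)=N^1$ with $\int_0^LN^1\,\mathrm{d}x=0$) such that $E(t,\cdot),V(t,\cdot)$ are continuously differentiable. Let $C_\infty>0$ be a constant, independent of $\Delta t,\Delta x,m$, such that for all sufficiently small $\Delta x$, whenever $(E^{(0)},N^{(0)},V^{(0)}),\dots,(E^{(m)},N^{(m)},V^{(m)})$ solve the DVDM scheme below (with the initial data below), one has $\|E^{(m)}\|_2,\|\delta_x^+E^{(m)}\|_2,\|E^{(m)}\|_\infty,\|N^{(m)}\|_2,\|\delta_x^+V^{(m)}\|_2\le C_\infty$. Let $p>3$ and $r\ge C_\infty$. Set $$\varepsilon_1(p,r)=\frac{2(p-3)\Delta x}{2+2p(p\hat L+1)r+p(p+1)r(\Delta x)^{1/2}+(2p^2\hat L+p+1)r\Delta x},$$ $$\varepsilon_2(p,r)=\frac{\Delta x}{r\left(2p\hat L+1+(p+1/2)(\Delta x)^{1/2}+(2p\hat L+1/2)\Delta x\right)}.$$ If $\Delta t$ and $\Delta x$ are sufficiently small and $\Delta t<\min\{\Delta x,\varepsilon_1(p,r),\varepsilon_2(p,r)\}$,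 then the DVDM scheme $$\begin{cases}\mathrm{i}\,\delta_t^+E^{(m)}_k=-\delta_x^{\langle 2\rangle}\mu_t^+E^{(m)}_k+(\mu_t^+N^{(m)}_k)(\mu_t^+E^{(m)}_k),\\ \delta_t^+N^{(m)}_k=\delta_x^{\langle 2\rangle}\mu_t^+V^{(m)}_k,\\ \delta_t^+V^{(m)}_k=\mu_t^+N^{(m)}_k+\mu_t^+|E^{(m)}_k|^2,\end{cases}$$ with $E^{(0)}_k=E^0(k\Delta x)$, $N^{(0)}_k=N^0(k\Delta x)$ and $|V^{(0)}_k-V(0,k\Delta x)|\le C_V(\Delta x)^2$ (for a constant $C_V$ independent of $\Delta x$), has a unique solution $(E^{(m)},N^{(m)},V^{(m)})$ for $m=1,2,\dots,M$.
   Context: Grid functions $u^{(m)}=(u^{(m)}_k)_{k\in\mathbb{Z}}$ are $K$-periodic in $k$. Operators: $\delta_x^+u_k=(u_{k+1}-u_k)/\Delta x$, $\delta_x^{\langle 2\rangle}u_k=(u_{k+1}-2u_k+u_{k-1})/(\Delta x)^2$, $\delta_t^+u^{(m)}_k=(u^{(m+1)}_k-u^{(m)}_k)/\Delta t$, $\mu_t^+u^{(m)}_k=(u^{(m+1)}_k+u^{(m)}_k)/2$. Norms: $\|v\|_p=(\sum_{k=1}^K|v_k|^p\Delta x)^{1/p}$, $\|v\|_\infty=\max_k|v_k|$. *)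

theory Defs
  imports "HOL-Analysis.Analysis"
begin

definition periodic_grid :: "nat \<Rightarrow> (int \<Rightarrow> 'a) \<Rightarrow> bool" where
  "periodic_grid K u \<longleftrightarrow> (\<forall>k. u (k + int K) = u k)"

definition dxp :: "real \<Rightarrow> (int \<Rightarrow> 'a::real_normed_field) \<Rightarrow> int \<Rightarrow> 'a" where
  "dxp dx u k = (u (k + 1) - u k) / of_real dx"

definition dx2 :: "real \<Rightarrow> (int \<Rightarrow> 'a::real_normed_field) \<Rightarrow> int \<Rightarrow> 'a" where
  "dx2 dx u k = (u (k + 1) - 2 * u k + u (k - 1)) / of_real (dx ^ 2)"

definition norm2 :: "nat \<Rightarrow> real \<Rightarrow> (int \<Rightarrow> 'a::real_normed_vector) \<Rightarrow> real" where
  "norm2 K dx v = sqrt (\<Sum>k\<in>{1..int K}. norm (v k) ^ 2 * dx)"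

definition norminf :: "nat \<Rightarrow> (int \<Rightarrow> 'a::real_normed_vector) \<Rightarrow> real" where
  "norminf K v = Max ((\<lambda>k. norm (v k)) ` {1..int K})"

definition dvdm_step :: "real \<Rightarrow> real \<Rightarrow> (int \<Rightarrow> complex) \<Rightarrow> (int \<Rightarrow> real) \<Rightarrow> (int \<Rightarrow> real)
    \<Rightarrow> (int \<Rightarrow> complex) \<Rightarrow> (int \<Rightarrow> real) \<Rightarrow> (int \<Rightarrow> real) \<Rightarrow> bool" where
  "dvdm_step dx dt E N V E' N' V' \<longleftrightarrow>
     (\<forall>k. \<i> * ((E' k - E k) / of_real dt)
            = - dx2 dx (\<lambda>j. (E' j + E j) / 2) k
              + of_real ((N' k + N k) / 2) * ((E' k + E k) / 2)
        \<and> (N' k - N k) / dt = dx2 dx (\<lambda>j. (V' j + V j) / 2) k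
        \<and> (V' k - V k) / dt = (N' k + N k) / 2 + ((cmod (E' k))\<^sup>2 + (cmod (E k))\<^sup>2) / 2)"

definition dvdm_sol :: "real \<Rightarrow> nat \<Rightarrow> real \<Rightarrow> nat \<Rightarrow> (real \<Rightarrow> complex) \<Rightarrow> (real \<Rightarrow> real)
    \<Rightarrow> (int \<Rightarrow> real) \<Rightarrow> (nat \<Rightarrow> int \<Rightarrow> complex) \<Rightarrow> (nat \<Rightarrow> int \<Rightarrow> real) \<Rightarrow> (nat \<Rightarrow> int \<Rightarrow> real) \<Rightarrow> bool" where
  "dvdm_sol L K dt m E0 N0 V0 Es Ns Vs \<longleftrightarrow>
     Es 0 = (\<lambda>k. E0 (real_of_int k * (L / real K))) \<and>
     Ns 0 = (\<lambda>k. N0 (real_of_int k * (L / real K))) \<and>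
     Vs 0 = V0 \<and>
     (\<forall>j\<le>m. periodic_grid K (Es j) \<and> periodic_grid K (Ns j) \<and> periodic_grid K (Vs j)) \<and>
     (\<forall>j<m. dvdm_step (L / real K) dt (Es j) (Ns j) (Vs j) (Es (Suc j)) (Ns (Suc j)) (Vs (Suc j)))"

definition Lhat :: "real \<Rightarrow> real" where
  "Lhat L = sqrt 2 * max (sqrt L) (1 / sqrt L)"

definition eps1 :: "real \<Rightarrow> real \<Rightarrow> real \<Rightarrow> real \<Rightarrow> real" where
  "eps1 L dx p r = 2 * (p - 3) * dx /
     (2 + 2 * p * (p * Lhat L + 1) * r + p * (p + 1) * r * sqrt dx
        + (2 * p\<^sup>2 * Lhat L + p + 1) * r * dx)"

definition eps2 :: "real \<Rightarrow> real \<Rightarrow> real \<Rightarrow> real \<Rightarrow> real" where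
  "eps2 L dx p r = dx /
     (r * (2 * p * Lhat L + 1 + (p + 1/2) * sqrt dx + (2 * p * Lhat L + 1/2) * dx))"

end

theory Submission
  imports Defs
begin

text \<open>
  In terms of the midpoints \<open>e\<close>, \<open>n\<close>, \<open>v\<close> of two consecutive time levels, one step reads
  \<open>e = E + (i dt/2) (e'' - n e)\<close>, \<open>n = N + (dt/2) v''\<close>, \<open>v = V + (dt/2) (n + s)\<close> with
  \<open>s = (|2e - E|\<^sup>2 + |E|\<^sup>2)/2\<close>, where primes denote central differences. For a given real \<open>n\<close> the
  first equation is linear with a skew-adjoint operator, so it has a unique solution \<open>e = e(n)\<close>; it
  obeys \<open>\<parallel>e\<parallel>\<^sub>2 \<le> \<parallel>E\<parallel>\<^sub>2\<close>, hence \<open>\<parallel>e\<parallel>\<^sub>\<infinity> \<le> r / \<surd>dx\<close>, and \<open>n \<mapsto> e(n)\<close> is Lipschitz with constant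
  \<open>(dt/2) r / \<surd>dx\<close>. Substituting \<open>e(n)\<close> and \<open>v\<close> into the second equation leaves a fixed point problem
  for \<open>n\<close> whose nonlinear part has Lipschitz constant at most \<open>3 (dt/dx) (dt r/dx)\<^sup>2\<close>; as
  \<open>dt < eps2\<close> forces \<open>7 dt r \<le> dx\<close>, it is solved by a contraction of the whole space of periodic
  grid functions. Uniqueness is therefore global, and the a priori bound on \<open>\<parallel>E\<parallel>\<^sub>2\<close> lets the
  step be repeated.\<close>

section \<open>Periodic grid functions and sums over one period\<close>

lemma periodic_grid_1:
  assumes "periodic_grid K u"
  shows "u (k + int K) = u k" "u (k - int K) = u k"
  using assms unfolding periodic_grid_def by (auto, metis diff_add_cancel)

lemma periodic_grid_mult:
  assumes "periodic_grid K u"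
  shows "u (k + j * int K) = u k"
proof (induction j arbitrary: k rule: int_induct[where k = 0])
  case (step1 i)
  then show ?case
    using periodic_grid_1(1)[OF assms, of "k + i * int K"] by (simp add: algebra_simps)
next
  case (step2 i)
  then show ?case
    using periodic_grid_1(2)[OF assms, of "k + i * int K"] by (simp add: algebra_simps)
qed simp

text \<open>Moves an arbitrary index into the window 1..K over which the norms sum. The index
  \<open>j\<close> depends on \<open>k\<close> alone, so the same one serves every periodic
  \<open>v\<close>.\<close>

lemma periodic_grid_representative:
  assumes "periodic_grid K u" "K > 0"
  obtains j where "j \<in> {1..int K}" "\<And>v. periodic_grid K v \<Longrightarrow> v k = v j"
proof
  \<comment> \<open>Shifting by one before and after \<open>mod\<close> turns the remainders 0..K-1
    into the window 1..K.\<close>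
  let ?j = "(k - 1) mod int K + 1"
  show "?j \<in> {1..int K}"
    using assms(2) pos_mod_bound[of "int K" "k - 1"] by (simp del: pos_mod_bound)
  show "v k = v ?j" if "periodic_grid K v" for v
    using periodic_grid_mult[OF that, of ?j "(k - 1) div int K"] by (simp add: algebra_simps)
qed

text \<open>The differences \<open>f (k + 1) - f k\<close> telescope to boundary values, which agree
  by periodicity. This is the discrete form of integrating a derivative over a full period.\<close>

lemma sum_periodic_shift:
  fixes f :: "int \<Rightarrow> 'a::real_normed_vector"
  assumes "periodic_grid K f"
  shows "(\<Sum>k\<in>{1..int K}. f (k + 1)) = (\<Sum>k\<in>{1..int K}. f k)"
proof -
  have "(\<Sum>k\<in>{1..int n}. f (k + 1) - f k) = f (int n + 1) - f 1" for n
  proof (induction n)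
    case (Suc n)
    have "{1..int (Suc n)} = insert (int n + 1) {1..int n}" by auto
    then show ?case using Suc by (simp add: add.commute)
  qed simp
  from this[of K] show ?thesis
    using periodic_grid_1(1)[OF assms, of 1] by (simp add: sum_subtractf add.commute)
qed

section \<open>Linearity and periodicity of the second difference\<close>

lemma dx2_add: "dx2 dx (\<lambda>k. u k + v k) k = dx2 dx u k + dx2 dx v k"
  unfolding dx2_def add_divide_distrib[symmetric] by (simp add: algebra_simps)

lemma dx2_diff: "dx2 dx (\<lambda>k. u k - v k) k = dx2 dx u k - dx2 dx v k"
  unfolding dx2_def diff_divide_distrib[symmetric] by (simp add: algebra_simps)

lemma dx2_scaleR: "dx2 dx (\<lambda>k. c *\<^sub>R u k) k = c *\<^sub>R dx2 dx u k"
  unfolding dx2_def by (simp add: scaleR_conv_of_real algebra_simps)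

lemma periodic_grid_dx2:
  "periodic_grid K u \<Longrightarrow> periodic_grid K (dx2 dx u)"
proof -
  assume u: "periodic_grid K u"
  have "u (k + int K + 1) = u (k + 1)" "u (k + int K - 1) = u (k - 1)" for k
    using periodic_grid_1(1)[OF u, of "k + 1"] periodic_grid_1(1)[OF u, of "k - 1"]
    by (simp_all add: algebra_simps)
  with u show ?thesis unfolding periodic_grid_def dx2_def by simp
qed

section \<open>The discrete L2 norm\<close>

locale grid =
  fixes K :: nat and dx :: real
  assumes K_pos: "K > 0" and dx_pos: "dx > 0"
begin

text \<open>Makes the Minkowski and Cauchy-Schwarz inequalities for \<open>L2_set\<close> available;
  the mesh weight is a mere factor \<open>sqrt dx\<close>.\<close>

lemma norm2_L2_set: "norm2 K dx u = sqrt dx * L2_set (\<lambda>k. norm (u k)) {1..int K}"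
  unfolding norm2_def L2_set_def
  by (simp add: real_sqrt_mult mult.commute flip: sum_distrib_left)

lemma norm2_nonneg: "0 \<le> norm2 K dx u"
  using dx_pos by (simp add: norm2_L2_set)

lemma norm2_square: "(norm2 K dx u)\<^sup>2 = dx * (\<Sum>k\<in>{1..int K}. (norm (u k))\<^sup>2)"
  using dx_pos by (simp add: norm2_L2_set L2_set_def power_mult_distrib sum_nonneg)

lemma norm2_le_mult:
  assumes "\<And>k. norm (u k) \<le> c * norm (v k)" "0 \<le> c"
  shows "norm2 K dx u \<le> c * norm2 K dx v"
proof -
  have "L2_set (\<lambda>k. norm (u k)) {1..int K} \<le> L2_set (\<lambda>k. c * norm (v k)) {1..int K}"
    by (rule L2_set_mono) (use assms in auto)
  then show ?thesis
    using dx_pos assms(2) by (simp add: norm2_L2_set mult.left_commute flip: L2_set_right_distrib)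
qed

lemma norm2_triangle: "norm2 K dx (\<lambda>k. u k + v k) \<le> norm2 K dx u + norm2 K dx v"
proof -
  have "L2_set (\<lambda>k. norm (u k + v k)) {1..int K} \<le> L2_set (\<lambda>k. norm (u k) + norm (v k)) {1..int K}"
    by (rule L2_set_mono) (auto simp: norm_triangle_ineq)
  also have "\<dots> \<le> L2_set (\<lambda>k. norm (u k)) {1..int K} + L2_set (\<lambda>k. norm (v k)) {1..int K}"
    by (rule L2_set_triangle_ineq)
  finally show ?thesis
    using dx_pos by (simp add: norm2_L2_set flip: distrib_left)
qed

text \<open>An inverse inequality: one entry is dominated by the unweighted L2 sum, at the price of
  \<open>1 / sqrt dx\<close>. It yields both the definiteness of the norm and the pointwise bounds
  on solutions.\<close>

lemma norm_le_norm2: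
  assumes "periodic_grid K u"
  shows "norm (u k) \<le> norm2 K dx u / sqrt dx"
proof -
  obtain j where j: "j \<in> {1..int K}" "\<And>v. periodic_grid K v \<Longrightarrow> (v::int\<Rightarrow>'a) k = v j"
    using periodic_grid_representative[OF assms K_pos] by blast
  have "norm (u k) \<le> L2_set (\<lambda>k. norm (u k)) {1..int K}"
    using member_le_L2_set[OF _ j(1), of "\<lambda>k. norm (u k)"] j(2)[OF assms] by simp
  then show ?thesis using dx_pos by (simp add: norm2_L2_set)
qed

lemma norm2_shift:
  assumes "periodic_grid K u"
  shows "norm2 K dx (\<lambda>k. u (k + 1)) = norm2 K dx u" "norm2 K dx (\<lambda>k. u (k - 1)) = norm2 K dx u"
proof -
  have *: "norm2 K dx (\<lambda>k. v (k + 1)) = norm2 K dx v" if "periodic_grid K v" for v :: "int \<Rightarrow> 'a"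
    using sum_periodic_shift[of K "\<lambda>k. norm (v k) ^ 2 * dx"] that
    unfolding norm2_def periodic_grid_def by simp
  show "norm2 K dx (\<lambda>k. u (k + 1)) = norm2 K dx u" by (rule *) fact
  have "periodic_grid K (\<lambda>k. u (k - 1))"
    using assms unfolding periodic_grid_def by (metis diff_add_eq)
  from *[OF this] show "norm2 K dx (\<lambda>k. u (k - 1)) = norm2 K dx u" by simp
qed

lemma norm2_scaleR: "norm2 K dx (\<lambda>k. c *\<^sub>R u k) = \<bar>c\<bar> * norm2 K dx u"
  by (simp add: norm2_L2_set flip: L2_set_right_distrib)

section \<open>Completeness and fixed points\<close>

text \<open>The norm sees the indices 1..K only, so distinct functions have positive distance
  because the carrier is restricted to periodic ones.\<close>

lemma Metric_space_norm2:
  "Metric_space {u::int \<Rightarrow> 'a::real_normed_vector. periodic_grid K u} (\<lambda>u v. norm2 K dx (\<lambda>k. u k - v k))"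
proof
  fix u v w :: "int \<Rightarrow> 'a"
  show "0 \<le> norm2 K dx (\<lambda>k. u k - v k)" by (rule norm2_nonneg)
  show "norm2 K dx (\<lambda>k. u k - v k) = norm2 K dx (\<lambda>k. v k - u k)"
    by (simp add: norm2_L2_set norm_minus_commute)
  show "norm2 K dx (\<lambda>k. u k - w k) \<le> norm2 K dx (\<lambda>k. u k - v k) + norm2 K dx (\<lambda>k. v k - w k)"
    using norm2_triangle[of "\<lambda>k. u k - v k" "\<lambda>k. v k - w k"] by simp
  assume "u \<in> {u. periodic_grid K u}" "v \<in> {u. periodic_grid K u}"
  then have "periodic_grid K (\<lambda>k. u k - v k)" by (simp add: periodic_grid_def)
  from norm_le_norm2[OF this] show "norm2 K dx (\<lambda>k. u k - v k) = 0 \<longleftrightarrow> u = v"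
    by (force simp: norm2_def)
qed

text \<open>A Cauchy sequence is Cauchy at each index by \<open>norm_le_norm2\<close>, and its
  pointwise limit is periodic. The norm is a finite sum, so pointwise convergence gives convergence
  in norm.\<close>

lemma mcomplete_norm2:
  "Metric_space.mcomplete {u::int \<Rightarrow> 'a::banach. periodic_grid K u}
     (\<lambda>u v. norm2 K dx (\<lambda>k. u k - v k))"
proof -
  interpret Metric_space "{u::int \<Rightarrow> 'a. periodic_grid K u}" "\<lambda>u v. norm2 K dx (\<lambda>k. u k - v k)"
    by (rule Metric_space_norm2)
  show ?thesis
    unfolding mcomplete_def
  proof (intro allI impI)
    fix \<sigma> assume \<sigma>: "MCauchy \<sigma>"
    then have per: "periodic_grid K (\<sigma> n)" for n by (auto simp: MCauchy_def)
    have "Cauchy (\<lambda>n. \<sigma> n k)" for k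
      unfolding Cauchy_def
    proof (intro allI impI)
      fix e :: real assume e: "e > 0"
      \<comment> \<open>The factor \<open>sqrt dx\<close> offsets the loss in
        \<open>norm_le_norm2\<close>.\<close>
      then have "e * sqrt dx > 0" using dx_pos by simp
      then obtain n0 where n0: "\<And>n m. n \<ge> n0 \<Longrightarrow> m \<ge> n0 \<Longrightarrow> norm2 K dx (\<lambda>k. \<sigma> n k - \<sigma> m k) < e * sqrt dx"
        using \<sigma> unfolding MCauchy_def by meson
      have "dist (\<sigma> n k) (\<sigma> m k) < e" if "n \<ge> n0" "m \<ge> n0" for n m
      proof -
        have "periodic_grid K (\<lambda>k. \<sigma> n k - \<sigma> m k)"
          using per[of n] per[of m] by (simp add: periodic_grid_def)
        from norm_le_norm2[OF this, of k]
        have "dist (\<sigma> n k) (\<sigma> m k) \<le> norm2 K dx (\<lambda>k. \<sigma> n k - \<sigma> m k) / sqrt dx"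
          by (simp add: dist_norm)
        also have "\<dots> < e" using n0[OF that] dx_pos by (simp add: pos_divide_less_eq)
        finally show ?thesis .
      qed
      then show "\<exists>M. \<forall>m\<ge>M. \<forall>n\<ge>M. dist (\<sigma> m k) (\<sigma> n k) < e" by blast
    qed
    then have "\<exists>l. (\<lambda>n. \<sigma> n k) \<longlonglongrightarrow> l" for k
      using Cauchy_convergent convergent_def by blast
    then obtain l where l: "\<And>k. (\<lambda>n. \<sigma> n k) \<longlonglongrightarrow> l k" by metis
    have "l (k + int K) = l k" for k
    proof (rule LIMSEQ_unique[OF _ l])
      show "(\<lambda>n. \<sigma> n k) \<longlonglongrightarrow> l (k + int K)"
        using l[of "k + int K"] per by (simp add: periodic_grid_def)
    qed
    then have lper: "periodic_grid K l" by (simp add: periodic_grid_def)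
    have "(\<lambda>n. norm2 K dx (\<lambda>k. \<sigma> n k - l k)) \<longlonglongrightarrow> norm2 K dx (\<lambda>k. l k - l k)"
      unfolding norm2_def by (intro tendsto_intros l)
    then have "(\<lambda>n. norm2 K dx (\<lambda>k. \<sigma> n k - l k)) \<longlonglongrightarrow> 0" by (simp add: norm2_def)
    then show "\<exists>l. limitin mtopology \<sigma> l sequentially"
      using per lper norm2_nonneg unfolding limit_metric_sequentially LIMSEQ_def
      by (intro exI[of _ l]) auto
  qed
qed

lemma periodic_contraction_fixpoint:
  fixes F :: "(int \<Rightarrow> 'a::banach) \<Rightarrow> (int \<Rightarrow> 'a)"
  assumes "c < 1"
    and "\<And>u. periodic_grid K u \<Longrightarrow> periodic_grid K (F u)"
    and "\<And>u v. periodic_grid K u \<Longrightarrow> periodic_grid K v \<Longrightarrow>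
      norm2 K dx (\<lambda>k. F u k - F v k) \<le> c * norm2 K dx (\<lambda>k. u k - v k)"
  obtains u where "periodic_grid K u" "F u = u"
proof -
  interpret Metric_space "{u::int \<Rightarrow> 'a. periodic_grid K u}" "\<lambda>u v. norm2 K dx (\<lambda>k. u k - v k)"
    by (rule Metric_space_norm2)
  have "(\<lambda>_. 0) \<in> {u::int \<Rightarrow> 'a. periodic_grid K u}" by (simp add: periodic_grid_def)
  then have "{u::int \<Rightarrow> 'a. periodic_grid K u} \<noteq> {}" by blast
  from mcomplete_norm2 this obtain u where "u \<in> {u. periodic_grid K u}" "F u = u"
    by (rule Banach_fixedpoint_thm[of F c]) (use assms in auto)
  then show ?thesis using that by simp
qed

section \<open>Norm bounds for the second difference\<close>

text \<open>Shifts preserve the norm, so the triangle inequality adds up the coefficients 1 + 2 + 1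
  = 4.\<close>

lemma norm2_dx2_le:
  fixes u :: "int \<Rightarrow> 'a::real_normed_field"
  assumes "periodic_grid K u"
  shows "norm2 K dx (dx2 dx u) \<le> 4 / dx\<^sup>2 * norm2 K dx u"
proof -
  have "norm2 K dx (dx2 dx u)
      = norm2 K dx (\<lambda>k. (1 / dx\<^sup>2) *\<^sub>R (u (k + 1) + ((-2) *\<^sub>R u k + u (k - 1))))"
    by (intro arg_cong[of _ _ "norm2 K dx"] ext) (simp add: dx2_def scaleR_conv_of_real)
  also have "\<dots> \<le> 1 / dx\<^sup>2 * (norm2 K dx u + (2 * norm2 K dx u + norm2 K dx u))"
    unfolding norm2_scaleR
    using norm2_triangle[of "\<lambda>k. u (k + 1)" "\<lambda>k. (-2) *\<^sub>R u k + u (k - 1)"]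
      norm2_triangle[of "\<lambda>k. (-2) *\<^sub>R u k" "\<lambda>k. u (k - 1)"] norm2_scaleR[of "-2" u] norm2_shift[OF assms]
    by (simp add: divide_right_mono)
  finally show ?thesis by simp
qed

text \<open>Under this CFL-type restriction, \<open>u + a u''\<close> is a convex combination of shifts of \<open>u\<close>.\<close>
lemma norm2_add_dx2_le:
  fixes u :: "int \<Rightarrow> 'a::real_normed_field"
  assumes "periodic_grid K u" "0 \<le> a" "2 * a \<le> dx\<^sup>2"
  shows "norm2 K dx (\<lambda>k. u k + a *\<^sub>R dx2 dx u k) \<le> norm2 K dx u"
proof -
  define b where "b = a / dx\<^sup>2"
  have b: "0 \<le> b" "2 * b \<le> 1" using assms dx_pos by (simp_all add: b_def)
  have "norm2 K dx (\<lambda>k. u k + a *\<^sub>R dx2 dx u k)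
      = norm2 K dx (\<lambda>k. b *\<^sub>R u (k + 1) + ((1 - 2 * b) *\<^sub>R u k + b *\<^sub>R u (k - 1)))"
    by (intro arg_cong[of _ _ "norm2 K dx"] ext)
      (simp add: dx2_def b_def scaleR_conv_of_real add_divide_distrib diff_divide_distrib algebra_simps)
  also have "\<dots> \<le> b * norm2 K dx u + ((1 - 2 * b) * norm2 K dx u + b * norm2 K dx u)"
    using norm2_triangle[of "\<lambda>k. b *\<^sub>R u (k + 1)" "\<lambda>k. (1 - 2 * b) *\<^sub>R u k + b *\<^sub>R u (k - 1)"]
      norm2_triangle[of "\<lambda>k. (1 - 2 * b) *\<^sub>R u k" "\<lambda>k. b *\<^sub>R u (k - 1)"] b
      norm2_scaleR[of b "\<lambda>k. u (k + 1)"] norm2_scaleR[of b "\<lambda>k. u (k - 1)"]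
      norm2_scaleR[of "1 - 2 * b" u] norm2_shift[OF assms(1)]
    by simp
  finally show ?thesis by (simp add: algebra_simps)
qed

section \<open>The linear Schroedinger equation with a given real potential\<close>

text \<open>The real potential and the diagonal of the second difference contribute purely imaginary
  terms. What remains is a difference of neighbouring fluxes, which telescopes over a
  period.\<close>

lemma schroedinger_skew:
  fixes w :: "int \<Rightarrow> complex" and n :: "int \<Rightarrow> real"
  assumes w: "periodic_grid K w"
  shows "(\<Sum>k\<in>{1..int K}. Re (cnj (w k) * (\<i> * (dx2 dx w k - of_real (n k) * w k)))) = 0"
proof -
  have *: "Re (cnj (w k) * (\<i> * (dx2 dx w k - of_real (n k) * w k)))
      = (Im (cnj (w (k - 1)) * w k) - Im (cnj (w k) * w (k + 1))) / dx\<^sup>2" for k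
    using dx_pos by (simp add: dx2_def field_simps)
  let ?f = "\<lambda>k. Im (cnj (w (k - 1)) * w k)"
  have "w (k + int K - 1) = w (k - 1)" for k
    using periodic_grid_1(1)[OF w, of "k - 1"] by (simp add: algebra_simps)
  then have "periodic_grid K ?f" using w by (simp add: periodic_grid_def)
  from sum_periodic_shift[OF this] show ?thesis
    unfolding * by (simp add: sum_subtractf flip: sum_divide_distrib)
qed

text \<open>Pairing the equation with \<open>cnj (e k)\<close> and summing removes the skew part;
  Cauchy-Schwarz bounds the rest. The estimate is uniform in \<open>c\<close> and in the
  potential.\<close>

lemma schroedinger_energy:
  fixes e g :: "int \<Rightarrow> complex" and n :: "int \<Rightarrow> real"
  assumes e: "periodic_grid K e"
    and eq: "\<And>k. e k = g k + of_real c * (\<i> * (dx2 dx e k - of_real (n k) * e k))"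
  shows "norm2 K dx e \<le> norm2 K dx g"
proof -
  let ?I = "{1..int K}"
  have "(\<Sum>k\<in>?I. (norm (e k))\<^sup>2) = (\<Sum>k\<in>?I. Re (cnj (e k) * g k)
     + c * Re (cnj (e k) * (\<i> * (dx2 dx e k - of_real (n k) * e k))))"
  proof (rule sum.cong[OF refl])
    fix k
    have "(norm (e k))\<^sup>2 = Re (cnj (e k) * e k)"
      by (simp add: cmod_power2 flip: power2_eq_square)
    also have "\<dots> = Re (cnj (e k) * (g k + of_real c * (\<i> * (dx2 dx e k - of_real (n k) * e k))))"
      using eq[of k] by simp
    also have "\<dots> = Re (cnj (e k) * g k + of_real c * (cnj (e k) * (\<i> * (dx2 dx e k - of_real (n k) * e k))))"
      by (simp only: distrib_left mult.left_commute)
    finally show "(norm (e k))\<^sup>2 = Re (cnj (e k) * g k)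
     + c * Re (cnj (e k) * (\<i> * (dx2 dx e k - of_real (n k) * e k)))" by simp
  qed
  also have "\<dots> = (\<Sum>k\<in>?I. Re (cnj (e k) * g k))"
    using schroedinger_skew[OF e, of n] by (simp only: sum.distrib flip: sum_distrib_left)
  also have "\<dots> \<le> (\<Sum>k\<in>?I. \<bar>norm (e k)\<bar> * \<bar>norm (g k)\<bar>)"
  proof (rule sum_mono)
    fix k
    show "Re (cnj (e k) * g k) \<le> \<bar>norm (e k)\<bar> * \<bar>norm (g k)\<bar>"
      using complex_Re_le_cmod[of "cnj (e k) * g k"] by (simp add: norm_mult)
  qed
  also have "\<dots> \<le> L2_set (\<lambda>k. norm (e k)) ?I * L2_set (\<lambda>k. norm (g k)) ?I"
    by (rule L2_set_mult_ineq)
  finally have "(norm2 K dx e)\<^sup>2 \<le> norm2 K dx e * norm2 K dx g"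
    unfolding norm2_square using dx_pos
    by (simp add: norm2_L2_set mult_left_mono mult.assoc mult.left_commute flip: mult.assoc[of "sqrt dx" "sqrt dx"])
  then show ?thesis
    using norm2_nonneg[of e] norm2_nonneg[of g] by (simp add: power2_eq_square mult_le_cancel_left) linarith
qed

text \<open>Under-relaxed Picard iteration converges however large the operator norm \<open>h\<close> is: by
  skewness the squared contraction factor is \<open>(1 - \<theta>)\<^sup>2 + \<theta>\<^sup>2 h\<^sup>2\<close>, which is below 1 for small \<open>\<theta>\<close>.\<close>
lemma schroedinger_solvable:
  fixes g :: "int \<Rightarrow> complex" and n :: "int \<Rightarrow> real"
  assumes g: "periodic_grid K g" and n: "periodic_grid K n"
  obtains e where "periodic_grid K e"
    "\<And>k. e k = g k + of_real c * (\<i> * (dx2 dx e k - of_real (n k) * e k))"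
proof -
  define H where "H w k = of_real c * (\<i> * (dx2 dx w k - of_real (n k) * w k))" for w :: "int \<Rightarrow> complex" and k
  \<comment> \<open>\<open>B\<close> bounds the potential pointwise by \<open>norm_le_norm2\<close>,
    and \<open>h\<close> then bounds the operator norm of \<open>H\<close>.\<close>
  define B where "B = norm2 K dx n / sqrt dx"
  define h where "h = \<bar>c\<bar> * (4 / dx\<^sup>2 + B)"
  \<comment> \<open>This \<theta> minimises
    \<open>(1 - \<theta>)\<^sup>2 + \<theta>\<^sup>2 * h\<^sup>2\<close>; the minimum is
    \<open>1 - \<theta>\<close>.\<close>
  define \<theta> where "\<theta> = 1 / (1 + h\<^sup>2)"
  define F where "F w k = (1 - \<theta>) *\<^sub>R w k + \<theta> *\<^sub>R (g k + H w k)" for w k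
  have B: "0 \<le> B" using dx_pos norm2_nonneg[of n] by (simp add: B_def)
  then have h: "0 \<le> h" using dx_pos by (simp add: h_def)
  have h1: "0 < 1 + h\<^sup>2" by (smt (verit) zero_le_power2)
  have \<theta>: "0 < \<theta>" "\<theta> \<le> 1" "\<theta> * (1 + h\<^sup>2) = 1" using h1 by (simp_all add: \<theta>_def)
  have H_per: "periodic_grid K (H w)" if "periodic_grid K w" for w
    using that n periodic_grid_dx2[OF that, of dx] by (simp add: H_def periodic_grid_def)
  have H_norm: "norm2 K dx (H w) \<le> h * norm2 K dx w" if w: "periodic_grid K w" for w
  proof -
    have "norm2 K dx (H w) \<le> \<bar>c\<bar> * norm2 K dx (\<lambda>k. dx2 dx w k + (- of_real (n k) * w k))"
      by (rule norm2_le_mult) (auto simp: H_def norm_mult)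
    also have "\<dots> \<le> \<bar>c\<bar> * (norm2 K dx (dx2 dx w) + norm2 K dx (\<lambda>k. - of_real (n k) * w k))"
      by (intro mult_left_mono norm2_triangle) auto
    also have "\<dots> \<le> \<bar>c\<bar> * (4 / dx\<^sup>2 * norm2 K dx w + B * norm2 K dx w)"
    proof (intro mult_left_mono add_mono norm2_dx2_le w norm2_le_mult)
      show "norm (- of_real (n k) * w k) \<le> B * norm (w k)" for k
        using norm_le_norm2[OF n, of k] by (simp only: norm_mult B_def mult_right_mono norm_minus_cancel norm_of_real real_norm_def norm_ge_zero)
    qed (use B in auto)
    finally show ?thesis by (simp add: h_def algebra_simps)
  qed
  have F_diff: "norm2 K dx (\<lambda>k. F u k - F v k) \<le> sqrt (1 - \<theta>) * norm2 K dx (\<lambda>k. u k - v k)"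
    if u: "periodic_grid K u" and v: "periodic_grid K v" for u v
  proof -
    define w where "w = (\<lambda>k. u k - v k)"
    have w_per: "periodic_grid K w" using u v by (simp add: periodic_grid_def w_def)
    have "dx2 dx w k = dx2 dx u k - dx2 dx v k" for k by (simp add: w_def dx2_diff)
    then have H: "H w k = H u k - H v k" for k by (simp add: H_def w_def right_diff_distrib)
    have "F u k - F v k = (1 - \<theta>) *\<^sub>R w k + \<theta> *\<^sub>R H w k" for k
      unfolding H by (simp add: F_def w_def scaleR_right_diff_distrib scaleR_add_right)
    \<comment> \<open>The cross term is a multiple of the skew form of
      \<open>schroedinger_skew\<close>, so it disappears on summation over a period.\<close>
    moreover have "(norm ((1 - \<theta>) *\<^sub>R w k + \<theta> *\<^sub>R H w k))\<^sup>2
        = (1 - \<theta>)\<^sup>2 * (norm (w k))\<^sup>2 + \<theta>\<^sup>2 * (norm (H w k))\<^sup>2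
        + 2 * (1 - \<theta>) * \<theta> * c * Re (cnj (w k) * (\<i> * (dx2 dx w k - of_real (n k) * w k)))" for k
    proof -
      define z where "z = \<i> * (dx2 dx w k - of_real (n k) * w k)"
      have "(norm (a + b))\<^sup>2 = (norm a)\<^sup>2 + (norm b)\<^sup>2 + 2 * Re (cnj a * b)" for a b :: complex
        unfolding cmod_power2 by (simp add: power2_eq_square algebra_simps)
      then have "(norm ((1 - \<theta>) *\<^sub>R w k + \<theta> *\<^sub>R H w k))\<^sup>2 = (norm ((1 - \<theta>) *\<^sub>R w k))\<^sup>2
          + (norm (\<theta> *\<^sub>R H w k))\<^sup>2 + 2 * Re (cnj ((1 - \<theta>) *\<^sub>R w k) * (\<theta> *\<^sub>R H w k))" .
      moreover have "2 * Re (cnj ((1 - \<theta>) *\<^sub>R w k) * (\<theta> *\<^sub>R H w k))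
          = 2 * (1 - \<theta>) * \<theta> * c * Re (cnj (w k) * z)"
        unfolding H_def z_def[symmetric] by (simp add: algebra_simps)
      ultimately show ?thesis
        by (simp add: z_def power_mult_distrib)
    qed
    ultimately have "(norm2 K dx (\<lambda>k. F u k - F v k))\<^sup>2
        = (1 - \<theta>)\<^sup>2 * (norm2 K dx w)\<^sup>2 + \<theta>\<^sup>2 * (norm2 K dx (H w))\<^sup>2"
      using schroedinger_skew[OF w_per, of n]
      by (simp only: norm2_square sum.distrib distrib_left flip: sum_distrib_left) (simp add: mult_ac)
    also have "\<dots> \<le> (1 - \<theta>)\<^sup>2 * (norm2 K dx w)\<^sup>2 + \<theta>\<^sup>2 * (h * norm2 K dx w)\<^sup>2"
      by (intro add_left_mono mult_left_mono power_mono H_norm w_per norm2_nonneg) auto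
    also have "\<dots> = (1 - 2 * \<theta> + \<theta> * (\<theta> * (1 + h\<^sup>2))) * (norm2 K dx w)\<^sup>2"
      by (simp add: power2_eq_square algebra_simps)
    also have "\<dots> = (sqrt (1 - \<theta>) * norm2 K dx w)\<^sup>2"
      using \<theta> by (simp add: power_mult_distrib)
    finally have "norm2 K dx (\<lambda>k. F u k - F v k) \<le> sqrt (1 - \<theta>) * norm2 K dx w"
      by (rule power2_le_imp_le) (use \<theta> norm2_nonneg[of w] in simp)
    then show ?thesis by (simp add: w_def)
  qed
  have "periodic_grid K (F u)" if "periodic_grid K u" for u
    using that g H_per[OF that] by (simp add: F_def periodic_grid_def)
  moreover have "sqrt (1 - \<theta>) < 1" using \<theta> by simp
  ultimately obtain e where e: "periodic_grid K e" "F e = e"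
    using periodic_contraction_fixpoint[of "sqrt (1 - \<theta>)" F] F_diff by blast
  have "e k = g k + H e k" for k
  proof -
    have "\<theta> *\<^sub>R (g k + H e k) = \<theta> *\<^sub>R e k"
      using fun_cong[OF e(2), of k] by (simp add: F_def scaleR_left_diff_distrib)
    then show ?thesis using \<theta>(1) by simp
  qed
  with e(1) show thesis using that by (simp add: H_def)
qed

lemma norm2_le_0_imp_eq:
  assumes "periodic_grid K u" "periodic_grid K v" "norm2 K dx (\<lambda>k. u k - v k) \<le> 0"
  shows "u = v"
proof
  fix k
  have "periodic_grid K (\<lambda>k. u k - v k)" using assms by (simp add: periodic_grid_def)
  from norm_le_norm2[OF this, of k] have "norm (u k - v k) \<le> 0"
    using assms(3) norm2_nonneg[of "\<lambda>k. u k - v k"] by simp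
  then show "u k = v k" by simp
qed

end

section \<open>One time step in midpoint variables\<close>

text \<open>If the new level is \<open>2 * e k - E k\<close>, the time average is \<open>e k\<close>
  and the time difference is \<open>2 * (e k - E k)\<close>. The substitution is invertible, so it
  neither loses nor adds solutions.\<close>

lemma dvdm_step_midpoint_iff:
  assumes "dt \<noteq> 0"
  shows "dvdm_step dx dt E N V (\<lambda>k. 2 * e k - E k) (\<lambda>k. 2 * n k - N k) (\<lambda>k. 2 * v k - V k) \<longleftrightarrow>
    (\<forall>k. e k = E k + of_real (dt / 2) * (\<i> * (dx2 dx e k - of_real (n k) * e k))) \<and>
    (\<forall>k. n k = N k + dt / 2 * dx2 dx v k) \<and>
    (\<forall>k. v k = V k + dt / 2 * (n k + ((cmod (2 * e k - E k))\<^sup>2 + (cmod (E k))\<^sup>2) / 2))"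
proof -
  have 1: "\<i> * ((2 * a - b - b) / of_real dt) = - A + B \<longleftrightarrow> a = b + of_real (dt / 2) * (\<i> * (A - B))"
    for a b A B :: complex
  proof -
    have "\<i> * ((2 * a - b - b) / of_real dt) = - A + B \<longleftrightarrow> \<i> * (2 * (a - b)) = (B - A) * of_real dt"
      using assms by (simp add: field_simps)
    \<comment> \<open>Multiplication by the nonzero number \<open>- \<i>\<close> cancels the leading
      \<open>\<i>\<close> and keeps the equivalence.\<close>
    also have "\<dots> \<longleftrightarrow> - \<i> * (\<i> * (2 * (a - b))) = - \<i> * ((B - A) * of_real dt)"
      by (metis complex_i_not_zero mult_cancel_left neg_equal_0_iff_equal)
    also have "\<dots> \<longleftrightarrow> a = b + of_real (dt / 2) * (\<i> * (A - B))"
    proof -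
      have "- \<i> * (\<i> * (2 * (a - b))) = 2 * (a - b)" by (simp flip: mult.assoc)
      moreover have "- \<i> * ((B - A) * of_real dt) = 2 * (of_real (dt / 2) * (\<i> * (A - B)))"
        by (simp add: algebra_simps)
      moreover have "2 * (a - b) = 2 * z \<longleftrightarrow> a = b + z" for z
        by (simp only: mult_cancel_left diff_eq_eq) (simp add: add.commute)
      ultimately show ?thesis by (simp only:)
    qed
    finally show ?thesis .
  qed
  have 2: "(2 * a - b - b) / dt = c \<longleftrightarrow> a = b + dt / 2 * c" for a b c :: real
    using assms by (auto simp: field_simps)
  have mid: "(2 * a - b + b) / 2 = a" for a b :: "'a::field_char_0" by simp
  show ?thesis
    unfolding dvdm_step_def by (simp only: 1 2 mid all_conj_distrib)
qed

context grid
begin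

text \<open>Since \<open>n1 e1 - n2 e2 = n1 (e1 - e2) + (n1 - n2) e2\<close>, the difference
  \<open>e1 - e2\<close> solves the equation with potential \<open>n1\<close> and source
  \<open>h\<close>, to which \<open>schroedinger_energy\<close> applies.\<close>

lemma schroedinger_potential_lipschitz:
  assumes per: "periodic_grid K n1" "periodic_grid K n2" "periodic_grid K e1" "periodic_grid K e2"
    and eq1: "\<And>k. e1 k = g k + of_real c * (\<i> * (dx2 dx e1 k - of_real (n1 k) * e1 k))"
    and eq2: "\<And>k. e2 k = g k + of_real c * (\<i> * (dx2 dx e2 k - of_real (n2 k) * e2 k))"
    and R: "\<And>k. cmod (e2 k) \<le> R" "0 \<le> R"
  shows "norm2 K dx (\<lambda>k. e1 k - e2 k) \<le> \<bar>c\<bar> * R * norm2 K dx (\<lambda>k. n1 k - n2 k)"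
proof -
  define w where "w = (\<lambda>k. e1 k - e2 k)"
  define h where "h k = - of_real c * (\<i> * (of_real (n1 k - n2 k) * e2 k))" for k
  have "periodic_grid K w" using per by (simp add: w_def periodic_grid_def)
  moreover have "w k = h k + of_real c * (\<i> * (dx2 dx w k - of_real (n1 k) * w k))" for k
  proof -
    have "w k = of_real c * (\<i> * (dx2 dx e1 k - of_real (n1 k) * e1 k))
        - of_real c * (\<i> * (dx2 dx e2 k - of_real (n2 k) * e2 k))"
      using eq1[of k] eq2[of k] by (simp add: w_def) (metis add_diff_cancel_left)
    then show ?thesis
      by (simp add: w_def h_def dx2_diff algebra_simps)
  qed
  ultimately have "norm2 K dx w \<le> norm2 K dx h" by (rule schroedinger_energy)
  also have "\<dots> \<le> (\<bar>c\<bar> * R) * norm2 K dx (\<lambda>k. n1 k - n2 k)"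
  proof (rule norm2_le_mult)
    fix k
    have "\<bar>c\<bar> * (\<bar>n1 k - n2 k\<bar> * cmod (e2 k)) \<le> \<bar>c\<bar> * (\<bar>n1 k - n2 k\<bar> * R)"
      by (intro mult_left_mono R) auto
    then show "cmod (h k) \<le> \<bar>c\<bar> * R * norm (n1 k - n2 k)"
      by (simp add: h_def norm_mult mult_ac flip: of_real_diff)
  qed (use R in auto)
  finally show ?thesis by (simp add: w_def)
qed

text \<open>Eliminating \<open>v\<close>, the midpoint density satisfies \<open>n = f + (dt\<^sup>2/4) (n + s)''\<close>. \<open>G\<close> is the average of
  this right-hand side with \<open>n\<close>: without averaging, the linear part alone would have norm
  \<open>(dt/dx)\<^sup>2\<close>, which leaves no room for the nonlinear part when \<open>dt\<close> is close to \<open>dx\<close>.\<close>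
lemma dvdm_density_contraction:
  fixes n1 n2 f :: "int \<Rightarrow> real" and e1 e2 g :: "int \<Rightarrow> complex" and dt r :: real
  defines "\<And>e. s e \<equiv> \<lambda>k. ((cmod (2 * e k - g k))\<^sup>2 + (cmod (g k))\<^sup>2) / 2"
  defines "\<And>n e. G n e \<equiv> \<lambda>k. (n k + (f k + dt\<^sup>2 / 4 * dx2 dx (\<lambda>j. n j + s e j) k)) / 2"
  assumes per: "periodic_grid K n1" "periodic_grid K n2" "periodic_grid K e1" "periodic_grid K e2" "periodic_grid K g"
    and eq1: "\<And>k. e1 k = g k + of_real (dt / 2) * (\<i> * (dx2 dx e1 k - of_real (n1 k) * e1 k))"
    and eq2: "\<And>k. e2 k = g k + of_real (dt / 2) * (\<i> * (dx2 dx e2 k - of_real (n2 k) * e2 k))"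
    and g: "norm2 K dx g \<le> r"
    and dt: "0 < dt" "dt \<le> dx" "7 * dt * r \<le> dx"
  shows "norm2 K dx (\<lambda>k. G n1 e1 k - G n2 e2 k) \<le> 3 / 4 * norm2 K dx (\<lambda>k. n1 k - n2 k)"
proof -
  \<comment> \<open>Pointwise bound for \<open>g\<close>, \<open>e1\<close> and \<open>e2\<close>:
    their norms are at most \<open>r\<close>, by \<open>schroedinger_energy\<close> in the last two
    cases.\<close>
  define R where "R = r / sqrt dx"
  define d where "d = norm2 K dx (\<lambda>k. n1 k - n2 k)"
  have d: "0 \<le> d" by (simp add: d_def norm2_nonneg)
  have r: "0 \<le> r" using g norm2_nonneg[of g] by linarith
  then have R0: "0 \<le> R" using dx_pos by (simp add: R_def)
  have R: "cmod (u k) \<le> R" if "periodic_grid K u" "norm2 K dx u \<le> norm2 K dx g" for u k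
    using norm_le_norm2[OF that(1), of k] that(2) g dx_pos
    by (simp add: R_def) (smt (verit) divide_right_mono real_sqrt_ge_zero)
  have gR: "cmod (g k) \<le> R" for k by (rule R) (use per in auto)
  have e1R: "cmod (e1 k) \<le> R" for k by (rule R) (use per schroedinger_energy[OF _ eq1] in auto)
  have e2R: "cmod (e2 k) \<le> R" for k by (rule R) (use per schroedinger_energy[OF _ eq2] in auto)
  \<comment> \<open>Factoring the difference of squares gives at most \<open>6 * R\<close> for the
    sum of the moduli; the 2 in \<open>?a - ?b = 2 * (e1 k - e2 k)\<close> cancels the division by
    2.\<close>
  have s_diff: "\<bar>s e1 k - s e2 k\<bar> \<le> 6 * R * cmod (e1 k - e2 k)" for k
  proof -
    let ?a = "2 * e1 k - g k" and ?b = "2 * e2 k - g k"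
    have ab: "cmod ?a \<le> 3 * R" "cmod ?b \<le> 3 * R"
      using norm_triangle_ineq4[of "2 * e1 k" "g k"] norm_triangle_ineq4[of "2 * e2 k" "g k"]
        e1R[of k] e2R[of k] gR[of k] by (simp_all add: norm_mult)
    have "\<bar>s e1 k - s e2 k\<bar> = (cmod ?a + cmod ?b) * \<bar>cmod ?a - cmod ?b\<bar> / 2"
      unfolding s_def diff_divide_distrib[symmetric]
      by (simp add: abs_mult power2_eq_square square_diff_square_factored)
    also have "\<dots> \<le> (6 * R) * cmod (?a - ?b) / 2"
      using ab norm_triangle_ineq3[of ?a ?b] R0 by (intro divide_right_mono mult_mono) auto
    also have "?a - ?b = 2 * (e1 k - e2 k)" by simp
    finally show ?thesis by (simp only: norm_mult) simp
  qed
  have "norm2 K dx (\<lambda>k. s e1 k - s e2 k) \<le> 6 * R * norm2 K dx (\<lambda>k. e1 k - e2 k)"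
    by (rule norm2_le_mult) (use s_diff R0 in auto)
  also have "\<dots> \<le> 6 * R * (\<bar>dt / 2\<bar> * R * d)"
    unfolding d_def using R0 per
    by (intro mult_left_mono schroedinger_potential_lipschitz[OF _ _ _ _ eq1 eq2] e2R) auto
  also have "\<dots> = 3 * dt * R\<^sup>2 * d" using dt by (simp add: power2_eq_square)
  finally have s_norm: "norm2 K dx (\<lambda>k. s e1 k - s e2 k) \<le> 3 * dt * R\<^sup>2 * d" .
  define z where "z = (\<lambda>k. s e1 k - s e2 k)"
  define y where "y = (\<lambda>k. n1 k - n2 k)"
  have z_per: "periodic_grid K z" and y_per: "periodic_grid K y"
    using per by (simp_all add: z_def s_def y_def periodic_grid_def)
  have "G n1 e1 k - G n2 e2 k
      = (1/2) *\<^sub>R ((y k + (dt\<^sup>2 / 4) *\<^sub>R dx2 dx y k) + (dt\<^sup>2 / 4) *\<^sub>R dx2 dx z k)" for k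
    unfolding G_def y_def z_def dx2_add dx2_diff
    by (simp add: algebra_simps add_divide_distrib diff_divide_distrib)
  then have "norm2 K dx (\<lambda>k. G n1 e1 k - G n2 e2 k)
      = 1 / 2 * norm2 K dx (\<lambda>k. (y k + (dt\<^sup>2 / 4) *\<^sub>R dx2 dx y k) + (dt\<^sup>2 / 4) *\<^sub>R dx2 dx z k)"
    by (simp only: norm2_scaleR)
  also have "\<dots> \<le> 1 / 2 * (norm2 K dx (\<lambda>k. y k + (dt\<^sup>2 / 4) *\<^sub>R dx2 dx y k)
      + norm2 K dx (\<lambda>k. (dt\<^sup>2 / 4) *\<^sub>R dx2 dx z k))"
    using norm2_triangle by (intro mult_left_mono) auto
  \<comment> \<open>The linear part is nonexpansive because \<open>dt \<le> dx\<close>, the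
    nonlinear part contributes at most half of \<open>d\<close>, and the averaging halves the sum to
    \<open>3 / 4 * d\<close>.\<close>
  also have "\<dots> \<le> 1 / 2 * (d + 1 / 2 * d)"
  proof (intro mult_left_mono add_mono)
    have dt2: "dt\<^sup>2 \<le> dx\<^sup>2" using dt by (intro power_mono) auto
    then show "norm2 K dx (\<lambda>k. y k + (dt\<^sup>2 / 4) *\<^sub>R dx2 dx y k) \<le> d"
      unfolding d_def y_def[symmetric]
      by (intro norm2_add_dx2_le y_per) (use dt2 zero_le_power2[of dt] zero_le_power2[of dx] in linarith)+
    have "norm2 K dx (\<lambda>k. (dt\<^sup>2 / 4) *\<^sub>R dx2 dx z k) \<le> dt\<^sup>2 / 4 * (4 / dx\<^sup>2 * (3 * dt * R\<^sup>2 * d))"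
      unfolding norm2_scaleR
      using norm2_dx2_le[OF z_per] s_norm[folded z_def] dx_pos
      by (smt (verit) divide_nonneg_nonneg mult_left_mono zero_le_power2)
    also have "\<dots> = 3 * ((dt / dx) * (dt * r / dx)\<^sup>2) * d"
      using dx_pos by (simp add: R_def power2_eq_square field_simps)
    \<comment> \<open>Here \<open>7 * dt * r \<le> dx\<close> enters: the nonlinear factor is at
      most 3/49.\<close>
    also have "\<dots> \<le> 3 * (1 * (1 / 7)\<^sup>2) * d"
    proof (intro mult_right_mono mult_left_mono mult_mono power_mono d)
      show "dt / dx \<le> 1" "dt * r / dx \<le> 1 / 7" using dt dx_pos by (simp_all add: field_simps)
      show "0 \<le> dt * r / dx" using dt dx_pos r by simp
    qed auto
    also have "\<dots> \<le> 1 / 2 * d" using d by (simp add: power2_eq_square)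
    finally show "norm2 K dx (\<lambda>k. (dt\<^sup>2 / 4) *\<^sub>R dx2 dx z k) \<le> 1 / 2 * d" .
  qed auto
  finally show ?thesis by (simp add: d_def)
qed

lemma dvdm_step_ex1:
  assumes per: "periodic_grid K E" "periodic_grid K N" "periodic_grid K V"
    and E: "norm2 K dx E \<le> r"
    and dt: "0 < dt" "dt \<le> dx" "7 * dt * r \<le> dx"
  shows "\<exists>!(E', N', V'). periodic_grid K E' \<and> periodic_grid K N' \<and> periodic_grid K V' \<and>
    dvdm_step dx dt E N V E' N' V'"
proof -
  define schr where "schr n e \<longleftrightarrow> periodic_grid K e \<and>
    (\<forall>k. e k = E k + of_real (dt / 2) * (\<i> * (dx2 dx e k - of_real (n k) * e k)))" for n e
  define s where "s e = (\<lambda>k. ((cmod (2 * e k - E k))\<^sup>2 + (cmod (E k))\<^sup>2) / 2)" for e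
  define f where "f k = N k + dt / 2 * dx2 dx V k" for k
  define G where "G n e = (\<lambda>k. (n k + (f k + dt\<^sup>2 / 4 * dx2 dx (\<lambda>j. n j + s e j) k)) / 2)" for n e
  define vel where "vel n e = (\<lambda>k. V k + dt / 2 * (n k + s e k))" for n e
  have s_per: "periodic_grid K (s e)" if "periodic_grid K e" for e
    using that per by (simp add: s_def periodic_grid_def)
  \<comment> \<open>Stated for arbitrary solutions \<open>e1\<close>, \<open>e2\<close> of the
    Schroedinger equations, so that it serves both the fixed point argument and the comparison with
    an unknown second solution.\<close>
  have contr: "norm2 K dx (\<lambda>k. G n1 e1 k - G n2 e2 k) \<le> 3 / 4 * norm2 K dx (\<lambda>k. n1 k - n2 k)"
    if "periodic_grid K n1" "periodic_grid K n2" "schr n1 e1" "schr n2 e2" for n1 n2 e1 e2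
    unfolding G_def s_def using that unfolding schr_def
    by (intro dvdm_density_contraction[OF _ _ _ _ per(1) _ _ E dt]) auto
  \<comment> \<open>Inserting the velocity equation into the density equation turns
    \<open>dt / 2\<close> into \<open>dt\<^sup>2 / 4\<close>; averaging with \<open>n\<close> leaves
    the fixed points unchanged.\<close>
  have wave_iff: "n = (\<lambda>k. N k + dt / 2 * dx2 dx (vel n e) k) \<longleftrightarrow> G n e = n" for n e
  proof -
    have "vel n e = (\<lambda>k. V k + (dt / 2) *\<^sub>R (n k + s e k))" by (simp add: vel_def)
    then have "dx2 dx (vel n e) k = dx2 dx V k + dt / 2 * dx2 dx (\<lambda>j. n j + s e j) k" for k
      using dx2_scaleR[of dx "dt / 2" "\<lambda>j. n j + s e j" k] by (simp add: dx2_add[of dx V])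
    then have "N k + dt / 2 * dx2 dx (vel n e) k = f k + dt\<^sup>2 / 4 * dx2 dx (\<lambda>j. n j + s e j) k" for k
      by (simp add: f_def power2_eq_square algebra_simps)
    moreover have "(a + b) / 2 = a \<longleftrightarrow> a = b" for a b :: real by auto
    ultimately show ?thesis by (simp only: G_def fun_eq_iff)
  qed
  have step_iff: "dvdm_step dx dt E N V (\<lambda>k. 2 * e k - E k) (\<lambda>k. 2 * n k - N k) (\<lambda>k. 2 * v k - V k)
      \<longleftrightarrow> schr n e \<and> G n e = n \<and> v = vel n e" if "periodic_grid K e" for e n v
  proof -
    have "dvdm_step dx dt E N V (\<lambda>k. 2 * e k - E k) (\<lambda>k. 2 * n k - N k) (\<lambda>k. 2 * v k - V k)
        \<longleftrightarrow> schr n e \<and> n = (\<lambda>k. N k + dt / 2 * dx2 dx v k) \<and> v = vel n e"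
      using that dt by (simp add: dvdm_step_midpoint_iff schr_def vel_def s_def fun_eq_iff)
    also have "\<dots> \<longleftrightarrow> schr n e \<and> n = (\<lambda>k. N k + dt / 2 * dx2 dx (vel n e) k) \<and> v = vel n e"
      by (cases "v = vel n e") simp_all
    finally show ?thesis unfolding wave_iff .
  qed
  have "\<exists>e. schr n e" if "periodic_grid K n" for n
    using schroedinger_solvable[OF per(1) that, of "dt / 2"] unfolding schr_def by metis
  then obtain S where S: "\<And>n. periodic_grid K n \<Longrightarrow> schr n (S n)" by metis
  have "periodic_grid K (G n (S n))" if n: "periodic_grid K n" for n
  proof -
    have "periodic_grid K (s (S n))" using S[OF n] by (auto simp: schr_def intro: s_per)
    then have "periodic_grid K (\<lambda>j. n j + s (S n) j)" using n by (simp add: periodic_grid_def)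
    from periodic_grid_dx2[OF this, of dx] periodic_grid_dx2[OF per(3), of dx] n per(2)
    show ?thesis by (simp add: G_def f_def periodic_grid_def)
  qed
  then obtain n where n: "periodic_grid K n" "G n (S n) = n"
    using periodic_contraction_fixpoint[of "3/4" "\<lambda>n. G n (S n)"] contr S by auto
  define e where "e = S n"
  have e: "schr n e" "periodic_grid K e" using S[OF n(1)] by (simp_all add: e_def schr_def)
  have unique: "n' = n \<and> e' = e" if "periodic_grid K n'" "schr n' e'" "G n' e' = n'" for n' e'
  proof
    have "norm2 K dx (\<lambda>k. n' k - n k) \<le> 3 / 4 * norm2 K dx (\<lambda>k. n' k - n k)"
      using contr[OF that(1) n(1) that(2) e(1)] that(3) n(2) by (simp add: e_def)
    then show "n' = n" by (intro norm2_le_0_imp_eq that n) linarith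
    then have e': "schr n e'" "periodic_grid K e'" using that by (auto simp: schr_def)
    \<comment> \<open>Both solutions now belong to the same potential \<open>n\<close>, so the
      right-hand side is zero.\<close>
    have "norm2 K dx (\<lambda>k. e' k - e k) \<le> \<bar>dt / 2\<bar> * (norm2 K dx e / sqrt dx) * norm2 K dx (\<lambda>k. n k - n k)"
      using e e' n(1) norm2_nonneg[of e] dx_pos unfolding schr_def
      by (intro schroedinger_potential_lipschitz[of n n e' e E]) (auto intro: norm_le_norm2)
    then show "e' = e" by (intro norm2_le_0_imp_eq e' e) (simp add: norm2_def)
  qed
  let ?E = "\<lambda>k. 2 * e k - E k" and ?N = "\<lambda>k. 2 * n k - N k" and ?V = "\<lambda>k. 2 * vel n e k - V k"
  show ?thesis
  proof (rule ex1I[of _ "(?E, ?N, ?V)"])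
    show "case (?E, ?N, ?V) of (E', N', V') \<Rightarrow>
      periodic_grid K E' \<and> periodic_grid K N' \<and> periodic_grid K V' \<and> dvdm_step dx dt E N V E' N' V'"
      using per e n s_per[OF e(2)] step_iff[OF e(2), of n "vel n e"]
      by (simp add: periodic_grid_def vel_def e_def)
  next
    fix X
    assume *: "case X of (E', N', V') \<Rightarrow>
      periodic_grid K E' \<and> periodic_grid K N' \<and> periodic_grid K V' \<and> dvdm_step dx dt E N V E' N' V'"
    obtain E' N' V' where X: "X = (E', N', V')" by (cases X)
    \<comment> \<open>A competing solution is rewritten through its midpoints, whatever its
      size.\<close>
    define e' n' v' where "e' = (\<lambda>k. (E' k + E k) / 2)" and "n' = (\<lambda>k. (N' k + N k) / 2)"
      and "v' = (\<lambda>k. (V' k + V k) / 2)"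
    have X': "E' = (\<lambda>k. 2 * e' k - E k)" "N' = (\<lambda>k. 2 * n' k - N k)" "V' = (\<lambda>k. 2 * v' k - V k)"
      by (simp_all add: e'_def n'_def v'_def add_divide_distrib)
    have per': "periodic_grid K e'" "periodic_grid K n'"
      using * X per by (simp_all add: e'_def n'_def periodic_grid_def)
    have "dvdm_step dx dt E N V E' N' V'" using * X by simp
    then have "schr n' e' \<and> G n' e' = n' \<and> v' = vel n' e'"
      using step_iff[OF per'(1), of n' v'] X' by simp
    with unique[OF per'(2)] have "n' = n" "e' = e" "v' = vel n e" by auto
    then show "X = (?E, ?N, ?V)" by (simp add: X X')
  qed
qed

end

section \<open>Iteration over the time levels\<close>

lemma dvdm_sol_le:
  "dvdm_sol L K dt m E0 N0 V0 Es Ns Vs \<Longrightarrow> j \<le> m \<Longrightarrow> dvdm_sol L K dt j E0 N0 V0 Es Ns Vs"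
  unfolding dvdm_sol_def by auto

text \<open>The bound is assumed for every partial solution, so each level reached supplies the norm
  hypothesis of the next step. Uniqueness concerns levels up to \<open>M\<close>, as
  \<open>dvdm_sol\<close> leaves later ones free.\<close>

lemma dvdm_sol_ex_unique:
  assumes K: "K > 0" and L: "L > 0"
    and E0: "\<And>x. E0 (x + L) = E0 x" and N0: "\<And>x. N0 (x + L) = N0 x" and V0: "periodic_grid K V0"
    and dt: "0 < dt" "dt \<le> L / real K" "7 * dt * r \<le> L / real K"
    and bound: "\<And>m Es Ns Vs. m < M \<Longrightarrow> dvdm_sol L K dt m E0 N0 V0 Es Ns Vs \<Longrightarrow>
      norm2 K (L / real K) (Es m) \<le> r"
  obtains Es Ns Vs where "dvdm_sol L K dt M E0 N0 V0 Es Ns Vs"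
    "\<And>Es' Ns' Vs' j. dvdm_sol L K dt M E0 N0 V0 Es' Ns' Vs' \<Longrightarrow> j \<le> M \<Longrightarrow>
      Es' j = Es j \<and> Ns' j = Ns j \<and> Vs' j = Vs j"
proof -
  let ?dx = "L / real K"
  interpret grid K ?dx using K L by unfold_locales auto
  have ex1: "\<exists>!(E', N', V'). periodic_grid K E' \<and> periodic_grid K N' \<and> periodic_grid K V' \<and>
      dvdm_step ?dx dt (Es m) (Ns m) (Vs m) E' N' V'"
    if "m < M" "dvdm_sol L K dt m E0 N0 V0 Es Ns Vs" for m Es Ns Vs
    using that bound[OF that] dt by (intro dvdm_step_ex1) (auto simp: dvdm_sol_def)
  have ex: "\<exists>Es Ns Vs. dvdm_sol L K dt m E0 N0 V0 Es Ns Vs" if "m \<le> M" for m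
    using that
  proof (induction m)
    case 0
    have *: "real_of_int (k + int K) * ?dx = real_of_int k * ?dx + L" for k
      using K by (simp add: field_simps)
    have "periodic_grid K (\<lambda>k. E0 (real_of_int k * ?dx))" "periodic_grid K (\<lambda>k. N0 (real_of_int k * ?dx))"
      unfolding periodic_grid_def * by (simp_all add: E0 N0)
    then have "dvdm_sol L K dt 0 E0 N0 V0 (\<lambda>_ k. E0 (real_of_int k * ?dx)) (\<lambda>_ k. N0 (real_of_int k * ?dx)) (\<lambda>_. V0)"
      using V0 by (simp add: dvdm_sol_def)
    then show ?case by blast
  next
    case (Suc m)
    then obtain Es Ns Vs where sol: "dvdm_sol L K dt m E0 N0 V0 Es Ns Vs" by auto
    obtain E' N' V' where step: "periodic_grid K E'" "periodic_grid K N'" "periodic_grid K V'"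
      "dvdm_step ?dx dt (Es m) (Ns m) (Vs m) E' N' V'"
      using ex1[OF _ sol] Suc.prems by auto
    \<comment> \<open>Overwriting index \<open>Suc m\<close> keeps all levels and steps already
      constructed.\<close>
    have "dvdm_sol L K dt (Suc m) E0 N0 V0 (Es(Suc m := E')) (Ns(Suc m := N')) (Vs(Suc m := V'))"
      using sol step unfolding dvdm_sol_def by (auto simp: le_Suc_eq less_Suc_eq)
    then show ?case by blast
  qed
  then obtain Es Ns Vs where sol: "dvdm_sol L K dt M E0 N0 V0 Es Ns Vs" by blast
  have "Es' j = Es j \<and> Ns' j = Ns j \<and> Vs' j = Vs j"
    if sol': "dvdm_sol L K dt M E0 N0 V0 Es' Ns' Vs'" and "j \<le> M" for Es' Ns' Vs' j
    using \<open>j \<le> M\<close>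
  proof (induction j)
    case 0
    show ?case using sol sol' by (simp add: dvdm_sol_def)
  next
    case (Suc j)
    then have IH: "Es' j = Es j" "Ns' j = Ns j" "Vs' j = Vs j" and j: "j < M" by auto
    let ?P = "\<lambda>(E', N', V'). periodic_grid K E' \<and> periodic_grid K N' \<and> periodic_grid K V' \<and>
      dvdm_step ?dx dt (Es j) (Ns j) (Vs j) E' N' V'"
    have "\<exists>!X. ?P X" by (rule ex1[OF j dvdm_sol_le[OF sol]]) (use j in simp)
    moreover have "?P (Es (Suc j), Ns (Suc j), Vs (Suc j))"
      using j sol by (auto simp: dvdm_sol_def)
    moreover have "?P (Es' (Suc j), Ns' (Suc j), Vs' (Suc j))"
      using j sol' unfolding IH[symmetric] by (auto simp: dvdm_sol_def)
    ultimately have "(Es' (Suc j), Ns' (Suc j), Vs' (Suc j)) = (Es (Suc j), Ns (Suc j), Vs (Suc j))"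
      by blast
    then show ?case by simp
  qed
  with sol show thesis using that by blast
qed

section \<open>The step size condition\<close>

text \<open>One of \<open>sqrt L\<close> and its reciprocal is at least 1.\<close>

lemma Lhat_ge_1: "L > 0 \<Longrightarrow> Lhat L \<ge> 1"
proof -
  assume L: "L > 0"
  have "max (sqrt L) (1 / sqrt L) \<ge> 1"
    using L by (cases "sqrt L \<ge> 1") (auto simp: field_simps le_max_iff_disj)
  from mult_mono[OF _ this, of 1 "sqrt 2"] show "Lhat L \<ge> 1"
    by (simp add: Lhat_def)
qed

text \<open>The denominator of \<open>eps2\<close> is \<open>r\<close> times at least 7:
  \<open>2 * p * Lhat L\<close> gives 6 since \<open>p > 3\<close> and
  \<open>Lhat L \<ge> 1\<close>, the constant term gives 1, and the other terms are
  nonnegative.\<close>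

lemma less_eps2_imp:
  assumes "L > 0" "dx > 0" "p > 3" "r > 0" "dt > 0" "dt < eps2 L dx p r"
  shows "7 * dt * r \<le> dx"
proof -
  let ?D = "2 * p * Lhat L + 1 + (p + 1/2) * sqrt dx + (2 * p * Lhat L + 1/2) * dx"
  have "6 \<le> 2 * p * Lhat L"
    using mult_mono[of 6 "2 * p" 1 "Lhat L"] Lhat_ge_1[OF assms(1)] assms(3) by simp
  moreover from this have "0 \<le> (2 * p * Lhat L + 1/2) * dx" "0 \<le> (p + 1/2) * sqrt dx"
    using assms(2,3) by (intro mult_nonneg_nonneg; simp)+
  ultimately have D: "7 \<le> ?D" by linarith
  have "dt * (r * ?D) < dx"
    using assms(4,6) D by (simp add: eps2_def pos_less_divide_eq)
  moreover have "dt * (r * 7) \<le> dt * (r * ?D)"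
    using D assms by (intro mult_left_mono) auto
  ultimately show ?thesis by (simp add: algebra_simps)
qed

theorem theorem3p2:
  fixes L T Cinf CV p r :: real
    and E Et Ex Exx :: "real \<Rightarrow> real \<Rightarrow> complex"
    and N Nt V Vt Vx Vxx :: "real \<Rightarrow> real \<Rightarrow> real"
  assumes L_pos: "L > 0" and T_pos: "T > 0"
    and E_t: "\<And>t x. t \<in> {0..T} \<Longrightarrow> ((\<lambda>s. E s x) has_vector_derivative Et t x) (at t within {0..T})"
    and E_x: "\<And>t x. t \<in> {0..T} \<Longrightarrow> ((\<lambda>y. E t y) has_vector_derivative Ex t x) (at x)"
    and E_xx: "\<And>t x. t \<in> {0..T} \<Longrightarrow> ((\<lambda>y. Ex t y) has_vector_derivative Exx t x) (at x)"
    and E_C1: "\<And>t. t \<in> {0..T} \<Longrightarrow> continuous_on UNIV (Ex t)"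
    and N_t: "\<And>t x. t \<in> {0..T} \<Longrightarrow> ((\<lambda>s. N s x) has_real_derivative Nt t x) (at t within {0..T})"
    and V_t: "\<And>t x. t \<in> {0..T} \<Longrightarrow> ((\<lambda>s. V s x) has_real_derivative Vt t x) (at t within {0..T})"
    and V_x: "\<And>t x. t \<in> {0..T} \<Longrightarrow> ((\<lambda>y. V t y) has_real_derivative Vx t x) (at x)"
    and V_xx: "\<And>t x. t \<in> {0..T} \<Longrightarrow> ((\<lambda>y. Vx t y) has_real_derivative Vxx t x) (at x)"
    and V_C1: "\<And>t. t \<in> {0..T} \<Longrightarrow> continuous_on UNIV (Vx t)"
    and eq_E: "\<And>t x. t \<in> {0..T} \<Longrightarrow> \<i> * Et t x + Exx t x = of_real (N t x) * E t x"
    and eq_N: "\<And>t x. t \<in> {0..T} \<Longrightarrow> Nt t x = Vxx t x"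
    and eq_V: "\<And>t x. t \<in> {0..T} \<Longrightarrow> Vt t x = N t x + (cmod (E t x))\<^sup>2"
    and V00: "V 0 0 = 0"
    and per: "\<And>t x. t \<in> {0..T} \<Longrightarrow> E t (x + L) = E t x \<and> N t (x + L) = N t x \<and> V t (x + L) = V t x"
    and N1_mean: "integral {0..L} (Nt 0) = 0"
    and Cinf_pos: "Cinf > 0"
    and Cinf_bound: "\<exists>\<delta>>0. \<forall>K M. K > 0 \<longrightarrow> M > 0 \<longrightarrow> L / real K < \<delta> \<longrightarrow>
        (\<forall>V0. periodic_grid K V0 \<longrightarrow>
           (\<forall>k. \<bar>V0 k - V 0 (real_of_int k * (L / real K))\<bar> \<le> CV * (L / real K)\<^sup>2) \<longrightarrow>
         (\<forall>m\<le>M. \<forall>Es Ns Vs. dvdm_sol L K (T / real M) m (E 0) (N 0) V0 Es Ns Vs \<longrightarrow>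
            norm2 K (L / real K) (Es m) \<le> Cinf \<and>
            norm2 K (L / real K) (dxp (L / real K) (Es m)) \<le> Cinf \<and>
            norminf K (Es m) \<le> Cinf \<and>
            norm2 K (L / real K) (Ns m) \<le> Cinf \<and>
            norm2 K (L / real K) (dxp (L / real K) (Vs m)) \<le> Cinf))"
    and p_gt: "p > 3" and r_ge: "r \<ge> Cinf"
  shows "\<exists>\<delta>>0. \<forall>K M. K > 0 \<longrightarrow> M > 0 \<longrightarrow> L / real K < \<delta> \<longrightarrow> T / real M < \<delta> \<longrightarrow>
           T / real M < L / real K \<longrightarrow>
           T / real M < eps1 L (L / real K) p r \<longrightarrow>
           T / real M < eps2 L (L / real K) p r \<longrightarrow>
        (\<forall>V0. periodic_grid K V0 \<longrightarrow>
           (\<forall>k. \<bar>V0 k - V 0 (real_of_int k * (L / real K))\<bar> \<le> CV * (L / real K)\<^sup>2) \<longrightarrow>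
         (\<exists>Es Ns Vs. dvdm_sol L K (T / real M) M (E 0) (N 0) V0 Es Ns Vs \<and>
            (\<forall>Es' Ns' Vs'. dvdm_sol L K (T / real M) M (E 0) (N 0) V0 Es' Ns' Vs' \<longrightarrow>
               (\<forall>j\<le>M. Es' j = Es j \<and> Ns' j = Ns j \<and> Vs' j = Vs j))))"
proof -
  have r: "r > 0" using Cinf_pos r_ge by simp
  have zero: "(0::real) \<in> {0..T}" using T_pos by simp
  obtain \<delta> where \<delta>: "\<delta> > 0"
    and bound: "\<And>K M V0 m Es Ns Vs. K > 0 \<Longrightarrow> M > 0 \<Longrightarrow> L / real K < \<delta> \<Longrightarrow> periodic_grid K V0 \<Longrightarrow>
      (\<And>k. \<bar>V0 k - V 0 (real_of_int k * (L / real K))\<bar> \<le> CV * (L / real K)\<^sup>2) \<Longrightarrow> m \<le> M \<Longrightarrow>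
      dvdm_sol L K (T / real M) m (E 0) (N 0) V0 Es Ns Vs \<Longrightarrow> norm2 K (L / real K) (Es m) \<le> Cinf"
  proof (rule exE[OF Cinf_bound], goal_cases)
    case (1 \<delta>)
    show ?case
    proof (rule 1(1))
      show "\<delta> > 0" using 1(2) by (rule conjunct1)
      fix K M V0 m Es Ns Vs
      assume *: "K > 0" "M > 0" "L / real K < \<delta>" "periodic_grid K V0"
        "\<And>k. \<bar>V0 k - V 0 (real_of_int k * (L / real K))\<bar> \<le> CV * (L / real K)\<^sup>2" "m \<le> M"
        "dvdm_sol L K (T / real M) m (E 0) (N 0) V0 Es Ns Vs"
      show "norm2 K (L / real K) (Es m) \<le> Cinf"
        by (rule conjunct2[OF 1(2), rule_format, THEN conjunct1, OF *])
    qed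
  qed
  show ?thesis
  \<comment> \<open>The threshold is the one below which the a priori bound holds; the contraction
    condition comes from \<open>eps2\<close>.\<close>
  proof (intro exI[of _ \<delta>] conjI \<delta> allI impI)
    fix K M V0
    assume K: "K > 0" and M: "M > 0" and dx: "L / real K < \<delta>"
      and dt: "T / real M < L / real K" "T / real M < eps2 L (L / real K) p r"
      and V0: "periodic_grid K V0"
        "\<forall>k. \<bar>V0 k - V 0 (real_of_int k * (L / real K))\<bar> \<le> CV * (L / real K)\<^sup>2"
    have dt': "0 < T / real M" "T / real M \<le> L / real K" using M T_pos dt(1) by simp_all
    have 7: "7 * (T / real M) * r \<le> L / real K"
      by (rule less_eps2_imp[OF L_pos _ p_gt r _ dt(2)]) (use K M L_pos T_pos in auto)
    have bd: "norm2 K (L / real K) (Es m) \<le> r"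
      if "m < M" "dvdm_sol L K (T / real M) m (E 0) (N 0) V0 Es Ns Vs" for m Es Ns Vs
      using bound[OF K M dx V0(1) _ _ that(2)] V0(2) that(1) r_ge by force
    have E0: "E 0 (x + L) = E 0 x" and N0: "N 0 (x + L) = N 0 x" for x using per[OF zero] by simp_all
    obtain Es Ns Vs where "dvdm_sol L K (T / real M) M (E 0) (N 0) V0 Es Ns Vs"
      "\<And>Es' Ns' Vs' j. dvdm_sol L K (T / real M) M (E 0) (N 0) V0 Es' Ns' Vs' \<Longrightarrow> j \<le> M \<Longrightarrow>
        Es' j = Es j \<and> Ns' j = Ns j \<and> Vs' j = Vs j"
    proof (rule dvdm_sol_ex_unique[of K L "E 0" "N 0" V0 "T / real M" r M])
      fix m Es Ns Vs
      assume "m < M" "dvdm_sol L K (T / real M) m (E 0) (N 0) V0 Es Ns Vs"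
      then show "norm2 K (L / real K) (Es m) \<le> r" by (rule bd)
    qed (use K L_pos E0 N0 V0(1) dt' 7 that in blast)+
    then show "\<exists>Es Ns Vs. dvdm_sol L K (T / real M) M (E 0) (N 0) V0 Es Ns Vs \<and>
            (\<forall>Es' Ns' Vs'. dvdm_sol L K (T / real M) M (E 0) (N 0) V0 Es' Ns' Vs' \<longrightarrow>
               (\<forall>j\<le>M. Es' j = Es j \<and> Ns' j = Ns j \<and> Vs' j = Vs j))"
      by blast
  qed
qed

end
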